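(* Let $X$ be a finite set, let $\mathcal B$ and $\mathcal B^*$ be pre-matroids on $X$, and let $B\mapsto B^*$ be a linking $\mathcal B\to\mathcal B^*$. If $\mathcal B$ is a matroid, then the Whitney multi-set $\mathbb W_\omega(\mathcal B\to\mathcal B^* )$ does not depend on the choice of the linear order $\omega$ on $X$.
   Context: A pre-matroid on a finite set $X$ is a non-empty set $\mathcal B$ of subsets of $X$, whose elements are called bases. For $Y\subseteq X$ and $x\in X\setminus Y$ write $Y+x=Y\cup\{x\}$; for $y\in Y$ write $Y-y=Y\setminus\{y\}$. An almost-basis of $\mathcal B$ is a set $B-x$ with $B\in\mathcal B$, $x\in B$; for an almost-basis $D$ let $U(D)=\{x\in X\setminus D: D+x\in\mathcal B\}$ (non-empty). $\mathcal B$ is a matroid if for all $B_1,B_2\in\mathcal B$ and $x\in B_1\setminus B_2$ there is $y\in B_2\setminus B_1$ with $B_1-x+y\in\mathcal B$. A transposition of $X$ is a permutation exchanging two distinct elements and fixing all others; permutations act on subsets elementwise. A bijection $\mathcal B\to\mathcal B^*$, $B\mapsto B^*$, between pre-matroids on $X$ is a linking if for every $B\in\mathcal B$ and every transposition $\tau$: (L1) if $\tau(B)\in\mathcal B$ then $\tau(B^* )\in\mathcal B^*$ and $\tau(B^* )=\tau(B)^*$; (L2) if $\tau(B^* )\in\mathcal B^*$ then $\tau(B)\in\mathcal B$ and $\tau(B^* )=\tau(B)^*$. For a linear order $\omega$ on $X$ and an almost-basis $D$ of a pre-matroid, let $\varphi_\omega(D)=D+\min_\omega U(D)$, a basis; for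 a basis $B$ let $i_\omega(B)$ be the number of almost-bases $D$ with $\varphi_\omega(D)=B$. These are computed in $\mathcal B$ for bases of $\mathcal B$ and in $\mathcal B^*$ for bases of $\mathcal B^*$. The Whitney multi-set $\mathbb W_\omega(\mathcal B\to\mathcal B^* )$ is the multi-subset of $\mathbb N\times\mathbb N$ (a function $\mathbb N\times\mathbb N\to\mathbb N$) assigning to $(p,q)$ the number of $B\in\mathcal B$ with $(i_\omega(B),i_\omega(B^* ))=(p,q)$. *)

theory Defs
  imports Main "HOL-Combinatorics.Transposition"
begin

definition pre_matroid :: "'a set \<Rightarrow> 'a set set \<Rightarrow> bool" where
  "pre_matroid X \<B> \<longleftrightarrow> finite X \<and> \<B> \<noteq> {} \<and> \<B> \<subseteq> Pow X"

definition matroid :: "'a set \<Rightarrow> 'a set set \<Rightarrow> bool" where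
  "matroid X \<B> \<longleftrightarrow> pre_matroid X \<B> \<and>
     (\<forall>B1\<in>\<B>. \<forall>B2\<in>\<B>. \<forall>x\<in>B1 - B2. \<exists>y\<in>B2 - B1. insert y (B1 - {x}) \<in> \<B>)"

definition almost_bases :: "'a set set \<Rightarrow> 'a set set" where
  "almost_bases \<B> = {B - {x} |B x. B \<in> \<B> \<and> x \<in> B}"

text \<open>The elements that complete the almost-basis \<open>D\<close> to a basis; written \<open>U(D)\<close>.\<close>

definition completions :: "'a set \<Rightarrow> 'a set set \<Rightarrow> 'a set \<Rightarrow> 'a set" where
  "completions X \<B> D = {x \<in> X - D. insert x D \<in> \<B>}"

definition transpositions :: "'a set \<Rightarrow> ('a \<Rightarrow> 'a) set" where
  "transpositions X = {transpose a b |a b. a \<in> X \<and> b \<in> X \<and> a \<noteq> b}"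

definition linking ::
  "'a set \<Rightarrow> 'a set set \<Rightarrow> 'a set set \<Rightarrow> ('a set \<Rightarrow> 'a set) \<Rightarrow> bool" where
  "linking X \<B> \<B>' l \<longleftrightarrow>
     pre_matroid X \<B> \<and> pre_matroid X \<B>' \<and> bij_betw l \<B> \<B>' \<and>
     (\<forall>B\<in>\<B>. \<forall>\<tau>\<in>transpositions X.
        (\<tau> ` B \<in> \<B> \<longrightarrow> \<tau> ` l B \<in> \<B>' \<and> \<tau> ` l B = l (\<tau> ` B)) \<and>
        (\<tau> ` l B \<in> \<B>' \<longrightarrow> \<tau> ` B \<in> \<B> \<and> \<tau> ` l B = l (\<tau> ` B)))"

text \<open>
  Linear orders on \<open>X\<close> are reflexive relations \<open>r\<close> with \<^term>\<open>linear_order_on X r\<close>;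
  \<open>(x, y) \<in> r\<close> means \<open>x \<le> y\<close>. As \<open>X\<close> is finite, \<open>r\<close> is a well-order with field \<open>X\<close>,
  so \<^const>\<open>wo_rel.minim\<close> gives the \<open>r\<close>-minimum of a non-empty subset of \<open>X\<close>.
\<close>

definition phi :: "'a set \<Rightarrow> 'a set set \<Rightarrow> 'a rel \<Rightarrow> 'a set \<Rightarrow> 'a set" where
  "phi X \<B> r D = insert (wo_rel.minim r (completions X \<B> D)) D"

definition int_activity :: "'a set \<Rightarrow> 'a set set \<Rightarrow> 'a rel \<Rightarrow> 'a set \<Rightarrow> nat" where
  "int_activity X \<B> r B = card {D \<in> almost_bases \<B>. phi X \<B> r D = B}"

definition whitney ::
  "'a set \<Rightarrow> 'a set set \<Rightarrow> 'a set set \<Rightarrow> ('a set \<Rightarrow> 'a set) \<Rightarrow> 'a rel \<Rightarrow> nat \<times> nat \<Rightarrow> nat" where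
  "whitney X \<B> \<B>' l r =
     (\<lambda>(p, q). card {B \<in> \<B>. (int_activity X \<B> r B, int_activity X \<B>' r (l B)) = (p, q)})"

end

theory Submission
  imports Defs
begin

text \<open>
  For a basis \<open>B\<close>, join \<open>x\<close> and \<open>y\<close> by an edge if the transposition of \<open>x\<close> and \<open>y\<close> carries \<open>B\<close> to a
  different basis; the linking preserves this graph. An element is active at \<open>B\<close> if it is smaller
  than all its neighbours, and \<open>i(B)\<close>, \<open>i(B*)\<close> are the numbers of active elements in \<open>B\<close> and in \<open>B*\<close>.

  Any two linear orders are connected by exchanges of consecutive elements \<open>a < b\<close>. Such an exchange
  alters the active elements of \<open>B\<close> only if \<open>a\<close> and \<open>b\<close> are joined at \<open>B\<close> and, apart from this edge,
  all neighbours of \<open>a\<close> or all neighbours of \<open>b\<close> are larger than both of them. In a matroid the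
  graphs at \<open>B\<close> and at its image \<open>\<tau>(B)\<close> are related by a pivot, which implies that for these \<open>B\<close> the
  new active elements of \<open>\<tau>(B)\<close> are the \<open>\<tau>\<close>-images of the old active elements of \<open>B\<close>. So applying
  \<open>\<tau>\<close> to exactly these bases is a bijection that matches the two multi-sets.
\<close>

section \<open>The exchange graph at a basis and its active elements\<close>

definition adj :: "'a set set \<Rightarrow> 'a set \<Rightarrow> 'a \<Rightarrow> 'a \<Rightarrow> bool" where
  "adj \<B> B x y \<longleftrightarrow> transpose x y ` B \<in> \<B> \<and> transpose x y ` B \<noteq> B"

definition active :: "'a set set \<Rightarrow> 'a rel \<Rightarrow> 'a set \<Rightarrow> 'a set" where
  "active \<B> r B = {x. \<forall>y. adj \<B> B x y \<longrightarrow> (x, y) \<in> r}"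

lemma transpose_image_exchange:
  assumes "x \<in> B" "y \<notin> B"
  shows "transpose x y ` B = insert y (B - {x})"
  using assms by (auto simp: in_transpose_image_iff transpose_def split: if_splits)

lemma adj_commute: "adj \<B> B x y \<longleftrightarrow> adj \<B> B y x"
  by (simp add: adj_def transpose_commute)

lemma adj_iff:
  "adj \<B> B x y \<longleftrightarrow> (x \<in> B \<and> y \<notin> B \<and> insert y (B - {x}) \<in> \<B>) \<or>
     (y \<in> B \<and> x \<notin> B \<and> insert x (B - {y}) \<in> \<B>)"
  using transpose_image_exchange[of x B y] transpose_image_exchange[of y B x]
  by (cases "x \<in> B"; cases "y \<in> B") (auto simp: adj_def transpose_commute[of y x])

lemma adj_in_carrier:
  assumes "\<B> \<subseteq> Pow X" "B \<in> \<B>" "adj \<B> B x y"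
  shows "x \<in> X" "y \<in> X"
  using assms by (auto simp: adj_iff)

text \<open>A proper exchange of \<open>x\<close> with \<open>a\<close> in \<open>B\<close> and one
  of \<open>x\<close> with \<open>b\<close> in the image of \<open>B\<close> lead to the same set,
  so pivoting along the edge swaps the roles of \<open>a\<close> and \<open>b\<close>.\<close>

lemma adj_transpose_endpoint:
  assumes "adj \<B> B a b" "x \<noteq> a" "x \<noteq> b"
  shows "adj \<B> (transpose a b ` B) b x \<longleftrightarrow> adj \<B> B a x"
proof -
  consider "a \<in> B" "b \<notin> B" | "b \<in> B" "a \<notin> B"
    using assms by (auto simp: adj_iff)
  then show ?thesis
  proof cases
    case 1
    have "insert x (insert b (B - {a}) - {b}) = insert x (B - {a})"
      using 1 by auto
    then show ?thesis
      using 1 assms by (auto simp: transpose_image_exchange adj_iff)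
  next
    case 2
    have *: "transpose a b ` B = insert a (B - {b})"
      using 2 transpose_image_exchange[of b B a] by (simp add: transpose_commute)
    have "insert b (insert a (B - {b}) - {x}) = insert a (B - {x})"
      using 2 assms by auto
    then show ?thesis
      using 2 assms by (auto simp: * adj_iff)
  qed
qed

section \<open>Pivoting the exchange graph of a matroid\<close>

lemma matroid_exchange:
  assumes "matroid X \<B>" "B1 \<in> \<B>" "B2 \<in> \<B>" "x \<in> B1 - B2"
  obtains y where "y \<in> B2 - B1" "insert y (B1 - {x}) \<in> \<B>"
  using assms unfolding matroid_def by blast

text \<open>Compare a 2-by-2 determinant with non-zero first diagonal entry: if an off-diagonal
  entry vanishes, only the other diagonal entry matters. In each direction two exchanges are made,
  each yielding the wanted basis or one of the two sets that \<open>not_both\<close> forbids to be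
  bases together.\<close>

lemma exchange_pivot:
  assumes M: "matroid X \<B>" and B: "B \<in> \<B>"
    and mem: "a \<in> B" "b \<notin> B" "x \<in> B" "y \<notin> B" "x \<noteq> a" "y \<noteq> b"
    and ab: "insert b (B - {a}) \<in> \<B>"
    and not_both: "\<not> (insert b (B - {x}) \<in> \<B> \<and> insert y (B - {a}) \<in> \<B>)"
  shows "insert y (insert b (B - {a}) - {x}) \<in> \<B> \<longleftrightarrow> insert y (B - {x}) \<in> \<B>"
    (is "?B2 \<in> \<B> \<longleftrightarrow> ?B1 \<in> \<B>")
proof
  assume B2: "?B2 \<in> \<B>"
  obtain u where u: "u \<in> ?B2 - B" "insert u (B - {x}) \<in> \<B>"
    using matroid_exchange[OF M B B2, of x] mem by auto
  obtain v where v: "v \<in> B - ?B2" "insert v (?B2 - {b}) \<in> \<B>"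
    using matroid_exchange[OF M B2 B, of b] mem by auto
  have "u = b \<or> u = y" "v = a \<or> v = x"
    using u v by auto
  moreover have "insert a (?B2 - {b}) = ?B1" "insert x (?B2 - {b}) = insert y (B - {a})"
    using mem by auto
  ultimately show "?B1 \<in> \<B>"
    using u(2) v(2) not_both by metis
next
  let ?C = "insert b (B - {a})"
  assume B1: "?B1 \<in> \<B>"
  obtain u where u: "u \<in> ?C - ?B1" "insert u (?B1 - {a}) \<in> \<B>"
    using matroid_exchange[OF M B1 ab, of a] mem by auto
  obtain v where v: "v \<in> ?B1 - ?C" "insert v (?C - {x}) \<in> \<B>"
    using matroid_exchange[OF M ab B1, of x] mem by auto
  have "u = b \<or> u = x" "v = a \<or> v = y"
    using u v by auto
  moreover have "insert b (?B1 - {a}) = ?B2" "insert x (?B1 - {a}) = insert y (B - {a})"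
    "insert a (?C - {x}) = insert b (B - {x})"
    using mem by auto
  ultimately show "?B2 \<in> \<B>"
    using u(2) v(2) not_both by metis
qed

lemma adj_pivot:
  assumes M: "matroid X \<B>" and B: "B \<in> \<B>" and ab: "adj \<B> B a b"
    and ne: "x \<noteq> a" "x \<noteq> b" "y \<noteq> a" "y \<noteq> b"
    and "\<not> (adj \<B> B x a \<and> adj \<B> B y b)" "\<not> (adj \<B> B x b \<and> adj \<B> B y a)"
  shows "adj \<B> (transpose a b ` B) x y \<longleftrightarrow> adj \<B> B x y"
proof -
  \<comment> \<open>Unless \<open>x\<close> and \<open>y\<close> both lie outside \<open>B\<close>,
    symmetry allows \<open>a\<close> and \<open>x\<close> to be in \<open>B\<close>. As these are
    then not adjacent, only the second excluded configuration has to be assumed.\<close>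
  have oriented: "adj \<B> (transpose a b ` B) x y \<longleftrightarrow> adj \<B> B x y"
    if "adj \<B> B a b" "a \<in> B" "x \<in> B" "x \<noteq> a" "x \<noteq> b" "y \<noteq> a" "y \<noteq> b"
      "\<not> (adj \<B> B x b \<and> adj \<B> B y a)" for a b x y
  proof -
    have b: "b \<notin> B" "insert b (B - {a}) \<in> \<B>"
      using that by (auto simp: adj_iff)
    have tr: "transpose a b ` B = insert b (B - {a})"
      using that b by (simp add: transpose_image_exchange)
    show ?thesis
    proof (cases "y \<in> B")
      case True
      then show ?thesis
        using that b by (auto simp: tr adj_iff)
    next
      case False
      have "insert y (insert b (B - {a}) - {x}) \<in> \<B> \<longleftrightarrow> insert y (B - {x}) \<in> \<B>"
        using that b False by (intro exchange_pivot[OF M B]) (auto simp: adj_iff)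
      then show ?thesis
        using that b False by (auto simp: tr adj_iff)
    qed
  qed
  have outside: ?thesis if "x \<notin> B" "y \<notin> B"
    using that ne by (auto simp: adj_def in_transpose_image_iff)
  consider "a \<in> B" "x \<in> B" | "a \<in> B" "y \<in> B" | "b \<in> B" "x \<in> B" | "b \<in> B" "y \<in> B"
    | "x \<notin> B" "y \<notin> B"
    using ab by (auto simp: adj_iff)
  then show ?thesis
  proof cases
    case 1
    then show ?thesis using oriented[of a b x y] assms by blast
  next
    case 2
    then show ?thesis using oriented[of a b y x] assms by (auto simp: adj_commute)
  next
    case 3
    then show ?thesis using oriented[of b a x y] assms
      by (auto simp: adj_commute[of \<B> B b a] transpose_commute)
  next
    case 4
    then show ?thesis using oriented[of b a y x] assms
      by (auto simp: adj_commute transpose_commute)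
  qed (rule outside)
qed

section \<open>Linear orders, minima and internal activity\<close>

lemma linear_order_onD:
  assumes "linear_order_on X r"
  shows linear_order_on_subset: "(x, y) \<in> r \<Longrightarrow> x \<in> X \<and> y \<in> X"
    and linear_order_on_refl: "x \<in> X \<Longrightarrow> (x, x) \<in> r"
    and linear_order_on_trans: "(x, y) \<in> r \<Longrightarrow> (y, z) \<in> r \<Longrightarrow> (x, z) \<in> r"
    and linear_order_on_antisym: "(x, y) \<in> r \<Longrightarrow> (y, x) \<in> r \<Longrightarrow> x = y"
    and linear_order_on_total: "x \<in> X \<Longrightarrow> y \<in> X \<Longrightarrow> (x, y) \<in> r \<or> (y, x) \<in> r"
proof -
  have r: "r \<subseteq> X \<times> X" "refl_on X r" "trans r" "antisym r" "total_on X r"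
    using assms by (simp_all add: order_on_defs)
  show "(x, y) \<in> r \<Longrightarrow> x \<in> X \<and> y \<in> X"
    using r(1) by blast
  show refl: "x \<in> X \<Longrightarrow> (x, x) \<in> r"
    using r(2) by (simp add: refl_on_def)
  show "(x, y) \<in> r \<Longrightarrow> (y, z) \<in> r \<Longrightarrow> (x, z) \<in> r"
    using r(3) by (rule transD)
  show "(x, y) \<in> r \<Longrightarrow> (y, x) \<in> r \<Longrightarrow> x = y"
    using r(4) by (rule antisymD)
  show "x \<in> X \<Longrightarrow> y \<in> X \<Longrightarrow> (x, y) \<in> r \<or> (y, x) \<in> r"
    using r(5) refl by (cases "x = y") (auto simp: total_on_def)
qed

lemma minim_eq_iff:
  assumes r: "linear_order_on X r" and "finite X" "A \<subseteq> X" "A \<noteq> {}"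
  shows "wo_rel.minim r A = m \<longleftrightarrow> m \<in> A \<and> (\<forall>a\<in>A. (m, a) \<in> r)"
proof -
  have Field: "Field r = X"
    using linear_order_on_subset[OF r] linear_order_on_refl[OF r] by (fastforce simp: Field_def)
  have "finite r"
    using assms linear_order_on_subset[OF r] by (intro finite_subset[of r "X \<times> X"]) auto
  moreover have "trans (r - Id)"
    using r unfolding order_on_defs by (auto intro: trans_diff_Id)
  then have "acyclic (r - Id)"
    by (simp add: acyclic_irrefl irrefl_def)
  ultimately have "Well_order r"
    using r Field by (simp add: well_order_on_def finite_acyclic_wf)
  then interpret wo_rel r
    by unfold_locales
  have "minim A \<in> A" "\<forall>a\<in>A. (minim A, a) \<in> r"
    using assms Field minim_in minim_least by auto
  then show ?thesis
    using linear_order_on_antisym[OF r] by blast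
qed

text \<open>For \<open>x\<close> in \<open>B\<close>, the completions of \<open>B - {x}\<close> are
  \<open>x\<close> and its neighbours, so \<open>x\<close> is active exactly when \<open>phi\<close>
  sends \<open>B - {x}\<close> back to \<open>B\<close>. Every almost-basis sent to \<open>B\<close>
  has this form for a unique \<open>x\<close>.\<close>

lemma int_activity_eq_card_active:
  assumes r: "linear_order_on X r" and B: "pre_matroid X \<B>" "B \<in> \<B>"
  shows "int_activity X \<B> r B = card (active \<B> r B \<inter> B)"
proof -
  have X: "finite X" "\<B> \<subseteq> Pow X" "B \<subseteq> X"
    using B by (auto simp: pre_matroid_def)
  \<comment> \<open>The minimum is meaningful only for a non-empty set; the element removed from a
    basis to form \<open>D\<close> is a completion.\<close>
  have min: "phi X \<B> r D = C \<longleftrightarrow>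
      (\<exists>m \<in> completions X \<B> D. (\<forall>y \<in> completions X \<B> D. (m, y) \<in> r) \<and> C = insert m D)"
    if D: "D \<in> almost_bases \<B>" for C D
  proof -
    obtain A x where "A \<in> \<B>" "x \<in> A" "D = A - {x}"
      using D unfolding almost_bases_def by blast
    then have "x \<in> completions X \<B> D"
      using X by (auto simp: completions_def insert_absorb)
    moreover have "completions X \<B> D \<subseteq> X"
      by (auto simp: completions_def)
    ultimately have "wo_rel.minim r (completions X \<B> D) = m \<longleftrightarrow>
        m \<in> completions X \<B> D \<and> (\<forall>y \<in> completions X \<B> D. (m, y) \<in> r)" for m
      using minim_eq_iff[OF r \<open>finite X\<close>, of "completions X \<B> D"] by blast
    then show ?thesis
      unfolding phi_def by metis
  qed
  have act: "x \<in> active \<B> r B \<longleftrightarrow> (\<forall>y \<in> completions X \<B> (B - {x}). (x, y) \<in> r)"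
    if "x \<in> B" for x
    using that X B linear_order_on_refl[OF r, of x]
    by (auto simp: active_def adj_iff completions_def)
  have "{D \<in> almost_bases \<B>. phi X \<B> r D = B} = (\<lambda>x. B - {x}) ` (active \<B> r B \<inter> B)"
  proof (intro set_eqI iffI)
    fix D assume D: "D \<in> {D \<in> almost_bases \<B>. phi X \<B> r D = B}"
    then obtain m where m: "m \<in> completions X \<B> D" "\<forall>y \<in> completions X \<B> D. (m, y) \<in> r"
      "B = insert m D"
      using min by blast
    then have "D = B - {m}" "m \<in> B"
      by (auto simp: completions_def)
    then show "D \<in> (\<lambda>x. B - {x}) ` (active \<B> r B \<inter> B)"
      using m act by auto
  next
    fix D assume "D \<in> (\<lambda>x. B - {x}) ` (active \<B> r B \<inter> B)"
    then obtain x where x: "x \<in> B" "x \<in> active \<B> r B" "D = B - {x}"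
      by auto
    then have D: "D \<in> almost_bases \<B>"
      using B by (auto simp: almost_bases_def)
    have "x \<in> completions X \<B> D" "B = insert x D"
      using x B X by (auto simp: completions_def insert_absorb)
    moreover have "\<forall>y \<in> completions X \<B> D. (x, y) \<in> r"
      using x act by simp
    ultimately have "phi X \<B> r D = B"
      using min[OF D, of B] by metis
    then show "D \<in> {D \<in> almost_bases \<B>. phi X \<B> r D = B}"
      using D by simp
  qed
  moreover have "inj_on (\<lambda>x. B - {x}) (active \<B> r B \<inter> B)"
    by (auto simp: inj_on_def)
  ultimately show ?thesis
    by (simp add: int_activity_def card_image)
qed

section \<open>Invariance of the exchange graph under a linking\<close>

lemma linking_adj:
  assumes l: "linking X \<B> \<B>' l" and B: "B \<in> \<B>" and xy: "x \<in> X" "y \<in> X"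
  shows "adj \<B>' (l B) x y \<longleftrightarrow> adj \<B> B x y"
proof (cases "x = y")
  case True
  then show ?thesis by (simp add: adj_def)
next
  case False
  then have t: "transpose x y \<in> transpositions X"
    using xy by (auto simp: transpositions_def)
  \<comment> \<open>Injectivity transfers the condition that the exchange really changes the
    basis.\<close>
  have "inj_on l \<B>"
    using l by (auto simp: linking_def bij_betw_def)
  then have "transpose x y ` B \<in> \<B> \<Longrightarrow> l (transpose x y ` B) = l B \<longleftrightarrow> transpose x y ` B = B"
    using B by (auto simp: inj_on_eq_iff)
  then show ?thesis
    using l B t unfolding linking_def adj_def by metis
qed

lemma linking_active:
  assumes "linking X \<B> \<B>' l" "B \<in> \<B>"
  shows "active \<B>' r (l B) = active \<B> r B"
proof -
  have "\<B> \<subseteq> Pow X" "\<B>' \<subseteq> Pow X" "l B \<in> \<B>'"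
    using assms by (auto simp: linking_def pre_matroid_def bij_betw_def)
  then have "adj \<B>' (l B) x y \<longleftrightarrow> adj \<B> B x y" for x y
    using assms linking_adj[OF assms] adj_in_carrier by metis
  then show ?thesis
    by (simp add: active_def)
qed

lemma linking_transpose:
  assumes "linking X \<B> \<B>' l" "B \<in> \<B>" "a \<in> X" "b \<in> X" "a \<noteq> b" "transpose a b ` B \<in> \<B>"
  shows "l (transpose a b ` B) = transpose a b ` l B"
proof -
  have "transpose a b \<in> transpositions X"
    using assms by (auto simp: transpositions_def)
  then show ?thesis
    using assms unfolding linking_def by metis
qed

section \<open>Exchanging consecutive elements of a linear order\<close>

definition swap_pair :: "'a rel \<Rightarrow> 'a \<Rightarrow> 'a \<Rightarrow> 'a rel" where
  "swap_pair r a b = insert (b, a) (r - {(a, b)})"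

definition consecutive :: "'a rel \<Rightarrow> 'a \<Rightarrow> 'a \<Rightarrow> bool" where
  "consecutive r a b \<longleftrightarrow> (a, b) \<in> r \<and> a \<noteq> b \<and>
     (\<forall>c. (a, c) \<in> r \<longrightarrow> (c, b) \<in> r \<longrightarrow> c = a \<or> c = b)"

locale consecutive_pair =
  fixes X :: "'a set" and r :: "'a rel" and a b :: 'a
  assumes r: "linear_order_on X r" and ab: "consecutive r a b"
begin

abbreviation "s \<equiv> swap_pair r a b"

lemma ab_simps: "a \<noteq> b" "a \<in> X" "b \<in> X" "(a, b) \<in> r" "(b, a) \<notin> r" "(a, a) \<in> r" "(b, b) \<in> r"
  using ab linear_order_on_subset[OF r] linear_order_on_antisym[OF r] linear_order_on_refl[OF r]
  by (auto simp: consecutive_def)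

lemma below_iff: "c \<noteq> a \<Longrightarrow> c \<noteq> b \<Longrightarrow> (c, b) \<in> r \<longleftrightarrow> (c, a) \<in> r"
  using ab linear_order_onD[OF r] unfolding consecutive_def by metis

lemma above_iff: "c \<noteq> a \<Longrightarrow> c \<noteq> b \<Longrightarrow> (b, c) \<in> r \<longleftrightarrow> (a, c) \<in> r"
  using ab linear_order_onD[OF r] unfolding consecutive_def by metis

text \<open>Consecutive elements compare alike with every third element, so reversing the single
  pair amounts to transporting \<open>r\<close> along the transposition. In this form the order
  axioms carry over from \<open>r\<close>.\<close>

lemma swap_pair_iff:
  "(x, y) \<in> s \<longleftrightarrow> (transpose a b x, transpose a b y) \<in> r"
  using ab_simps below_iff above_iff unfolding swap_pair_def transpose_def by auto

lemma linear_order_swap_pair: "linear_order_on X s"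
proof -
  have mem: "transpose a b x \<in> X \<longleftrightarrow> x \<in> X" for x
    using ab_simps by (auto simp: transpose_def)
  have "s \<subseteq> X \<times> X"
    using ab_simps linear_order_on_subset[OF r] by (auto simp: swap_pair_def)
  moreover have "refl_on X s"
    using linear_order_on_refl[OF r] mem by (auto simp: refl_on_def swap_pair_iff)
  moreover have "trans s"
    using linear_order_on_trans[OF r] by (auto simp: trans_def swap_pair_iff)
  moreover have "antisym s"
    by (auto simp: antisym_def swap_pair_iff
        dest!: linear_order_on_antisym[OF r] injD[OF inj_transpose])
  moreover have "total_on X s"
    using linear_order_on_total[OF r] mem by (auto simp: total_on_def swap_pair_iff)
  ultimately show ?thesis
    by (simp add: order_on_defs)
qed

end

text \<open>Among the pairs of \<open>r\<close> missing from \<open>r'\<close>, take one with the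
  smallest \<open>r\<close>-interval. A point strictly between would split it into two pairs with
  smaller intervals, hence both in \<open>r'\<close>, and transitivity would put the pair itself
  into \<open>r'\<close>.\<close>

lemma exists_consecutive_inversion:
  assumes X: "finite X" and r: "linear_order_on X r" and r': "linear_order_on X r'"
    and ne: "r \<noteq> r'"
  obtains a b where "consecutive r a b" "(a, b) \<notin> r'" "(b, a) \<in> r'"
proof -
  define I where "I p = {c. (fst p, c) \<in> r \<and> (c, snd p) \<in> r}" for p
  have finI: "finite (I p)" for p
    using linear_order_on_subset[OF r] by (intro finite_subset[OF _ X]) (auto simp: I_def)
  \<comment> \<open>By totality and antisymmetry, a linear order on \<open>X\<close> contained in
    another one equals it.\<close>
  have "r - r' \<noteq> {}"
  proof
    assume "r - r' = {}"
    then have "r \<subseteq> r'" by auto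
    moreover have "r' \<subseteq> r"
    proof (rule subrelI)
      fix x y assume xy: "(x, y) \<in> r'"
      then have "x \<in> X" "y \<in> X"
        using linear_order_on_subset[OF r'] by auto
      then show "(x, y) \<in> r"
        using \<open>r \<subseteq> r'\<close> linear_order_on_total[OF r] linear_order_on_antisym[OF r' xy] by blast
    qed
    ultimately show False
      using ne by simp
  qed
  then obtain p where p: "p \<in> r - r'" "\<And>q. q \<in> r - r' \<Longrightarrow> card (I p) \<le> card (I q)"
    using ex_has_least_nat[of "\<lambda>p. p \<in> r - r'" _ "\<lambda>p. card (I p)"] by blast
  obtain a b where p_eq: "p = (a, b)"
    by (cases p)
  have ab: "(a, b) \<in> r" "(a, b) \<notin> r'" "a \<in> X" "b \<in> X"
    using p p_eq linear_order_on_subset[OF r, of a b] by auto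
  have "c = a \<or> c = b" if c: "(a, c) \<in> r" "(c, b) \<in> r" for c
  proof (rule ccontr)
    assume cab: "\<not> (c = a \<or> c = b)"
    have sub: "I (a, c) \<subseteq> I (a, b)" "I (c, b) \<subseteq> I (a, b)"
      using c linear_order_on_trans[OF r] by (auto simp: I_def)
    have "b \<in> I (a, b)" "b \<notin> I (a, c)" "a \<in> I (a, b)" "a \<notin> I (c, b)"
      using ab c cab linear_order_on_refl[OF r] linear_order_on_antisym[OF r]
      by (auto simp: I_def)
    then have "card (I (a, c)) < card (I (a, b))" "card (I (c, b)) < card (I (a, b))"
      using sub finI by (auto intro!: psubset_card_mono)
    then have "(a, c) \<in> r'" "(c, b) \<in> r'"
      using p(2)[of "(a, c)"] p(2)[of "(c, b)"] p_eq c by auto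
    then show False
      using ab linear_order_on_trans[OF r'] by blast
  qed
  moreover have "a \<noteq> b"
    using ab linear_order_on_refl[OF r'] by auto
  moreover have "(b, a) \<in> r'"
    using ab linear_order_on_total[OF r'] by blast
  ultimately show ?thesis
    using that ab by (auto simp: consecutive_def)
qed

text \<open>Bubble sort: swapping a consecutive inversion removes one pair from
  \<open>r - r'\<close> and adds none, since the new pair \<open>(b, a)\<close> lies in
  \<open>r'\<close>.\<close>

lemma linear_order_swap_induct [consumes 3, case_names refl swap]:
  assumes X: "finite X" and r: "linear_order_on X r" and r': "linear_order_on X r'"
    and refl: "P r'"
    and swap: "\<And>r a b. linear_order_on X r \<Longrightarrow> consecutive r a b \<Longrightarrow> P (swap_pair r a b) \<Longrightarrow> P r"
  shows "P r"
  using r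
proof (induction "card (r - r')" arbitrary: r rule: less_induct)
  case less
  show ?case
  proof (cases "r = r'")
    case True
    then show ?thesis using refl by simp
  next
    case False
    obtain a b where inv: "consecutive r a b" "(a, b) \<notin> r'" "(b, a) \<in> r'"
      using exists_consecutive_inversion[OF X less.prems r' False] .
    interpret consecutive_pair X r a b
      using less.prems inv by unfold_locales
    have "finite r"
      using X linear_order_on_subset[OF less.prems] by (intro finite_subset[of r "X \<times> X"]) auto
    moreover have "swap_pair r a b - r' \<subseteq> r - r' - {(a, b)}" "(a, b) \<in> r - r'"
      using inv(2,3) ab_simps(1,4) by (auto simp: swap_pair_def)
    then have "swap_pair r a b - r' \<subset> r - r'"
      by blast
    ultimately have "card (swap_pair r a b - r') < card (r - r')"
      by (intro psubset_card_mono) auto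
    then have "P (swap_pair r a b)"
      using linear_order_swap_pair by (rule less.hyps)
    then show ?thesis
      by (rule swap[OF less.prems inv(1)])
  qed
qed

section \<open>The effect of one exchange on the active elements and on the multi-set\<close>

locale consecutive_pair_matroid = consecutive_pair X r a b
  for X :: "'a set" and r a b +
  fixes \<B> :: "'a set set"
  assumes M: "matroid X \<B>"
begin

abbreviation \<tau> :: "'a set \<Rightarrow> 'a set" where "\<tau> B \<equiv> transpose a b ` B"

text \<open>The bases at which exchanging \<open>a\<close> and \<open>b\<close> in the order changes the active elements.\<close>

definition critical :: "'a set \<Rightarrow> bool" where
  "critical B \<longleftrightarrow> adj \<B> B a b \<and>
     ((\<forall>y. adj \<B> B a y \<longrightarrow> (a, y) \<in> r) \<or> (\<forall>y. adj \<B> B b y \<longrightarrow> (a, y) \<in> r))"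

lemma adj_transpose: "B \<in> \<B> \<Longrightarrow> adj \<B> B a b \<Longrightarrow> adj \<B> (\<tau> B) a b"
  by (auto simp: adj_def image_comp)

lemma adj_transpose_b: "adj \<B> B a b \<Longrightarrow> x \<noteq> a \<Longrightarrow> x \<noteq> b \<Longrightarrow> adj \<B> (\<tau> B) b x \<longleftrightarrow> adj \<B> B a x"
  by (rule adj_transpose_endpoint)

lemma adj_transpose_a: "adj \<B> B a b \<Longrightarrow> x \<noteq> a \<Longrightarrow> x \<noteq> b \<Longrightarrow> adj \<B> (\<tau> B) a x \<longleftrightarrow> adj \<B> B b x"
  using adj_transpose_endpoint[of \<B> B b a x] by (simp add: adj_commute[of \<B> B b a] transpose_commute)

text \<open>Pivoting swaps the neighbourhoods of \<open>a\<close> and \<open>b\<close> away from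
  their edge, hence merely swaps the two alternatives in \<open>critical\<close>. This lets the map
  on bases in \<open>whitney_swap\<close> be an involution.\<close>

lemma critical_transpose:
  assumes "B \<in> \<B>" "critical B"
  shows "critical (\<tau> B)"
proof -
  have ab: "adj \<B> B a b"
    using assms by (simp add: critical_def)
  have "(\<forall>y. adj \<B> (\<tau> B) b y \<longrightarrow> (a, y) \<in> r)" if "\<forall>y. adj \<B> B a y \<longrightarrow> (a, y) \<in> r"
    using that adj_transpose_b[OF ab] ab_simps by metis
  moreover have "(\<forall>y. adj \<B> (\<tau> B) a y \<longrightarrow> (a, y) \<in> r)" if "\<forall>y. adj \<B> B b y \<longrightarrow> (a, y) \<in> r"
    using that adj_transpose_a[OF ab] ab_simps by metis
  ultimately show ?thesis
    using assms adj_transpose[OF assms(1) ab] unfolding critical_def by blast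
qed

text \<open>A new neighbour \<open>y\<close> of \<open>x\<close> other than \<open>a\<close> and
  \<open>b\<close> can arise only if \<open>x\<close> and \<open>y\<close> are attached to different
  ends of the edge; criticality then makes \<open>y\<close> large enough.\<close>

lemma active_transpose_other:
  assumes B: "B \<in> \<B>" and crit: "critical B" and x: "x \<noteq> a" "x \<noteq> b" "x \<in> active \<B> r B"
  shows "x \<in> active \<B> r (\<tau> B)"
proof -
  have ab: "adj \<B> B a b"
    using crit by (simp add: critical_def)
  have le: "adj \<B> B x y \<Longrightarrow> (x, y) \<in> r" for y
    using x by (simp add: active_def)
  have le_a: "(x, a) \<in> r" if "adj \<B> B x a \<or> adj \<B> B x b"
    using that le below_iff x by blast
  have "(x, y) \<in> r" if y: "adj \<B> (\<tau> B) x y" for y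
  proof -
    consider "y = a" | "y = b" | "y \<noteq> a" "y \<noteq> b" "adj \<B> B x y"
      | "y \<noteq> a" "y \<noteq> b" "adj \<B> B x a" "adj \<B> B y b"
      | "y \<noteq> a" "y \<noteq> b" "adj \<B> B x b" "adj \<B> B y a"
      using adj_pivot[OF M B ab x(1,2)] y by blast
    then show ?thesis
    proof cases
      case 1
      then show ?thesis
        using y adj_transpose_a[OF ab x(1,2)] le_a by (simp add: adj_commute)
    next
      case 2
      then show ?thesis
        using y adj_transpose_b[OF ab x(1,2)] le_a below_iff[OF x(1,2)] by (simp add: adj_commute)
    next
      case 3
      then show ?thesis using le by simp
    next
      case 4
      \<comment> \<open>The neighbour \<open>x\<close> of \<open>a\<close> is smaller than
        \<open>a\<close>, which refutes one alternative of \<open>critical\<close>. The other one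
        applies to the neighbour \<open>y\<close> of \<open>b\<close>, so \<open>x\<close> <
        \<open>a\<close> \<le> \<open>y\<close>.\<close>
      then have xa: "(x, a) \<in> r" "(a, x) \<notin> r"
        using le_a x linear_order_on_antisym[OF r] by auto
      then have "(a, y) \<in> r"
        using 4 crit unfolding critical_def by (metis adj_commute)
      then show ?thesis
        using xa linear_order_on_trans[OF r] by blast
    next
      case 5
      then have xa: "(x, a) \<in> r" "(a, x) \<notin> r"
        using le_a x linear_order_on_antisym[OF r] by auto
      then have "(a, y) \<in> r"
        using 5 crit unfolding critical_def by (metis adj_commute)
      then show ?thesis
        using xa linear_order_on_trans[OF r] by blast
    qed
  qed
  then show ?thesis
    by (simp add: active_def)
qed

lemma active_swap_other: "x \<noteq> a \<Longrightarrow> x \<noteq> b \<Longrightarrow> x \<in> active \<B> s B \<longleftrightarrow> x \<in> active \<B> r B"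
  by (auto simp: active_def swap_pair_def)

text \<open>The larger end of an edge is never active, which settles \<open>a\<close> at
  \<open>\<tau> B\<close> against \<open>b\<close> at \<open>B\<close>. For \<open>b\<close> at
  \<open>\<tau> B\<close>, both the graph and the order are relabelled from those for
  \<open>a\<close> at \<open>B\<close>.\<close>

lemma active_swap_critical:
  assumes B: "B \<in> \<B>" and crit: "critical B"
  shows "active \<B> s (\<tau> B) = \<tau> (active \<B> r B)"
proof (rule set_eqI)
  fix x
  have ab: "adj \<B> B a b" "adj \<B> (\<tau> B) a b"
    using crit adj_transpose[OF B] by (simp_all add: critical_def)
  have tB: "\<tau> B \<in> \<B>" "\<tau> (\<tau> B) = B"
    using ab by (simp_all add: adj_def image_comp)
  have tr: "x \<in> \<tau> (active \<B> r B) \<longleftrightarrow> transpose a b x \<in> active \<B> r B"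
    by (simp add: in_transpose_image_iff)
  consider "x = a" | "x = b" | "x \<noteq> a" "x \<noteq> b"
    by blast
  then show "x \<in> active \<B> s (\<tau> B) \<longleftrightarrow> x \<in> \<tau> (active \<B> r B)"
  proof cases
    case 1
    have "(a, b) \<notin> s"
      using ab_simps by (simp add: swap_pair_def)
    then have "a \<notin> active \<B> s (\<tau> B)" "b \<notin> active \<B> r B"
      using ab ab_simps adj_commute[of \<B> B a b] by (auto simp: active_def)
    then show ?thesis
      using 1 tr by simp
  next
    case 2
    have "adj \<B> (\<tau> B) b (transpose a b y) \<longleftrightarrow> adj \<B> B a y" for y
      using ab adj_transpose_b[OF ab(1), of y] adj_commute[of \<B> "\<tau> B" a b]
      by (cases "y = a"; cases "y = b") (auto simp: adj_iff[of \<B> _ a a] adj_iff[of \<B> _ b b])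
    then have "b \<in> active \<B> s (\<tau> B) \<longleftrightarrow> a \<in> active \<B> r B"
      unfolding active_def swap_pair_iff
      by (simp) (metis transpose_involutory)
    then show ?thesis
      using 2 tr by simp
  next
    case 3
    \<comment> \<open>One direction comes from \<open>B\<close>, the other from the critical basis
      \<open>\<tau> B\<close>, whose image is \<open>B\<close> again.\<close>
    have "x \<in> active \<B> r (\<tau> B) \<longleftrightarrow> x \<in> active \<B> r B"
      using active_transpose_other[OF B crit 3]
        active_transpose_other[OF tB(1) critical_transpose[OF B crit] 3] tB(2) by auto
    then show ?thesis
      using 3 tr active_swap_other by simp
  qed
qed

text \<open>If \<open>a\<close> and \<open>b\<close> are not adjacent, their mutual order is
  irrelevant. If they are, then in either order the larger is inactive because of the edge, and the
  smaller because it has a neighbour \<open>y\<close> with \<open>(a, y) \<notin> r\<close>.\<close>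

lemma active_swap_not_critical:
  assumes crit: "\<not> critical B"
  shows "active \<B> s B = active \<B> r B"
proof (rule set_eqI)
  fix x
  consider "x = a \<or> x = b" "adj \<B> B a b" | "x = a \<or> x = b" "\<not> adj \<B> B a b" | "x \<noteq> a" "x \<noteq> b"
    by blast
  then show "x \<in> active \<B> s B \<longleftrightarrow> x \<in> active \<B> r B"
  proof cases
    case 1
    have "adj \<B> B b a"
      using 1 by (simp add: adj_commute)
    have "a \<notin> active \<B> r B" "\<not> (\<forall>y. adj \<B> B b y \<longrightarrow> (a, y) \<in> r)"
      using 1 crit by (auto simp: critical_def active_def)
    moreover have "a \<notin> active \<B> s B" "b \<notin> active \<B> r B"
      using 1 \<open>adj \<B> B b a\<close> ab_simps by (auto simp: active_def swap_pair_def)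
    moreover have "(a, y) \<in> r" if "(b, y) \<in> s" for y
      using that ab_simps above_iff[of y] by (cases "y = a"; cases "y = b") (auto simp: swap_pair_def)
    ultimately show ?thesis
      using 1(1) by (auto simp: active_def)
  next
    case 2
    then have "\<not> adj \<B> B b a"
      by (simp add: adj_commute)
    then show ?thesis
      using 2 by (auto simp: active_def swap_pair_def)
  qed (rule active_swap_other)
qed

lemma whitney_swap:
  assumes l: "linking X \<B> \<B>' l"
  shows "whitney X \<B> \<B>' l r = whitney X \<B> \<B>' l s"
proof -
  have pre: "pre_matroid X \<B>" "pre_matroid X \<B>'" and lB: "\<And>B. B \<in> \<B> \<Longrightarrow> l B \<in> \<B>'"
    using l by (auto simp: linking_def bij_betw_def)
  define w where "w t B = (int_activity X \<B> t B, int_activity X \<B>' t (l B))" for t B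
  have w: "w t B = (card (active \<B> t B \<inter> B), card (active \<B> t B \<inter> l B))"
    if "linear_order_on X t" "B \<in> \<B>" for t B
    using that pre lB linking_active[OF l]
    by (simp add: w_def int_activity_eq_card_active[of X t])
  \<comment> \<open>This involution on the bases carries the activity pairs for \<open>r\<close> to
    those for \<open>s\<close> and so serves as its own inverse between the sets being
    counted.\<close>
  define f where "f B = (if critical B then \<tau> B else B)" for B
  have critD: "\<tau> B \<in> \<B>" if "critical B" for B
    using that by (simp add: critical_def adj_def)
  have f: "f B \<in> \<B>" "f (f B) = B" if "B \<in> \<B>" for B
    using that critD critical_transpose[OF that] by (simp_all add: f_def image_comp)
  have wf: "w s (f B) = w r B" if B: "B \<in> \<B>" for B
  proof (cases "critical B")
    case True
    \<comment> \<open>As \<open>l\<close> commutes with this exchange, the same permutation moves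
      the active set, \<open>B\<close> and \<open>l B\<close>, and both cardinalities
      survive.\<close>
    have "l (\<tau> B) = \<tau> (l B)"
      using linking_transpose[OF l B _ _ _ critD[OF True]] ab_simps by simp
    moreover have "card (\<tau> A \<inter> \<tau> C) = card (A \<inter> C)" for A C
      by (simp add: image_Int[symmetric] inj_transpose card_image)
    ultimately show ?thesis
      using True B critD[OF True]
      by (simp add: f_def w[OF r] w[OF linear_order_swap_pair] active_swap_critical)
  next
    case False
    then show ?thesis
      using B by (simp add: f_def w[OF r] w[OF linear_order_swap_pair] active_swap_not_critical)
  qed
  have "bij_betw f {B \<in> \<B>. w r B = pq} {B \<in> \<B>. w s B = pq}" for pq
    by (rule bij_betw_byWitness[where f' = f]) (use f wf in \<open>auto, metis\<close>)
  then have "card {B \<in> \<B>. w r B = pq} = card {B \<in> \<B>. w s B = pq}" for pq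
    by (rule bij_betw_same_card)
  then show ?thesis
    by (simp only: whitney_def w_def)
qed

end

theorem theorem7p1:
  fixes X :: "'a set" and \<B> \<B>' :: "'a set set" and l :: "'a set \<Rightarrow> 'a set"
    and r r' :: "'a rel"
  assumes "finite X"
    and "pre_matroid X \<B>" and "pre_matroid X \<B>'"
    and "linking X \<B> \<B>' l"
    and "matroid X \<B>"
    and "linear_order_on X r" and "linear_order_on X r'"
  shows "whitney X \<B> \<B>' l r = whitney X \<B> \<B>' l r'"
  using assms(1,6,7)
proof (induction rule: linear_order_swap_induct)
  case refl
  show ?case ..
next
  case (swap r a b)
  interpret consecutive_pair_matroid X r a b \<B>
    using swap assms by unfold_locales
  show ?case
    using whitney_swap[OF assms(4)] swap by simp
qed

end
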